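(* Assume Schanuel's Conjecture. Let $p(x,y)\in\overline{\mathbb{Q}}[x,y]$ be irreducible, depending on both $x$ and $y$, and not of the form $c\,y^{m}$ with $c\in\mathbb{C}$, $m\in\mathbb{N}$. Then there exists $w\in\mathbb{C}$ such that $p(w,e^{e^w})=0$ and $\operatorname{td}_{\mathbb{Q}}(w,e^w,e^{e^w})=2$.
   Context: $\overline{\mathbb{Q}}$ is the field of algebraic numbers and $\operatorname{td}_{\mathbb{Q}}$ denotes transcendence degree over $\mathbb{Q}$ of the field generated. Schanuel's Conjecture: if $\lambda_1,\dots,\lambda_n\in\mathbb{C}$ are linearly independent over $\mathbb{Q}$, then $\operatorname{td}_{\mathbb{Q}}\mathbb{Q}(\lambda_1,\dots,\lambda_n,e^{\lambda_1},\dots,e^{\lambda_n})\ge n$. *)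

theory Defs
  imports
    Complex_Main
    "HOL-Computational_Algebra.Computational_Algebra"
    "HOL-Library.Poly_Mapping"
    "HOL-Library.Extended_Nat"
begin

definition is_subfield :: "complex set \<Rightarrow> bool" where
  "is_subfield K \<longleftrightarrow> 0 \<in> K \<and> 1 \<in> K
     \<and> (\<forall>a\<in>K. \<forall>b\<in>K. a + b \<in> K \<and> a * b \<in> K)
     \<and> (\<forall>a\<in>K. - a \<in> K \<and> inverse a \<in> K)"

text \<open>The field generated by \<open>S\<close> over the rationals; every subfield of the complex
  numbers contains the rationals, so they need not be adjoined explicitly.\<close>

definition rat_adjoin :: "complex set \<Rightarrow> complex set" where
  "rat_adjoin S = is_subfield hull S"

lemma subset_rat_adjoin: "S \<subseteq> rat_adjoin S"
  unfolding rat_adjoin_def by (rule hull_subset)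

lemma is_subfield_rat_adjoin: "is_subfield (rat_adjoin S)"
  unfolding rat_adjoin_def hull_def is_subfield_def by auto

text \<open>Polynomials over the rationals in variables indexed by arbitrary complex numbers:
  a monomial is a finitely supported exponent function, and a polynomial a finitely supported
  coefficient function on monomials. The variable indexed by \<open>a\<close> is evaluated at \<open>a\<close>.\<close>

definition mpoly_eval :: "((complex \<Rightarrow>\<^sub>0 nat) \<Rightarrow>\<^sub>0 rat) \<Rightarrow> complex" where
  "mpoly_eval P = (\<Sum>m\<in>Poly_Mapping.keys P. of_rat (Poly_Mapping.lookup P m) *
     (\<Prod>a\<in>Poly_Mapping.keys m. a ^ Poly_Mapping.lookup m a))"

definition alg_indep :: "complex set \<Rightarrow> bool" where
  "alg_indep A \<longleftrightarrow>
     (\<forall>P. (\<forall>m\<in>Poly_Mapping.keys P. Poly_Mapping.keys m \<subseteq> A) \<and> mpoly_eval P = 0 \<longrightarrow> P = 0)"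

text \<open>The transcendence degree over the rationals of the field generated by \<open>S\<close>, as the largest
  size of an algebraically independent subset of that field (\<open>\<infinity>\<close> if there is no bound).\<close>

definition trdeg :: "complex set \<Rightarrow> enat" where
  "trdeg S = (SUP A\<in>{A. finite A \<and> A \<subseteq> rat_adjoin S \<and> alg_indep A}. enat (card A))"

text \<open>The set \<open>l ` {1..n}\<close> loses repetitions, so linear independence of the family
  \<open>l 1, \<dots>, l n\<close> is injectivity together with linear independence of the set.\<close>

definition schanuel_conjecture :: bool where
  "schanuel_conjecture \<longleftrightarrow>
     (\<forall>(n::nat) (l :: nat \<Rightarrow> complex).
        inj_on l {1..n} \<and> module.independent (\<lambda>(q::rat) (z::complex). of_rat q * z) (l ` {1..n})
        \<longrightarrow> enat n \<le> trdeg (l ` {1..n} \<union> (\<lambda>i. exp (l i)) ` {1..n}))"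

text \<open>A bivariate polynomial \<open>p(x, y)\<close> is a polynomial in \<open>y\<close> whose coefficients are
  polynomials in \<open>x\<close>.\<close>

definition eval2 :: "complex poly poly \<Rightarrow> complex \<Rightarrow> complex \<Rightarrow> complex" where
  "eval2 p x y = poly (poly p [:y:]) x"

lemma eval2_altdef: "eval2 p x y = (\<Sum>j\<le>degree p. poly (coeff p j) x * y ^ j)"
  by (simp add: eval2_def poly_altdef[of p] poly_sum poly_power)

definition algebraic_poly2 :: "complex poly poly set" where
  "algebraic_poly2 = {p. \<forall>i j. algebraic (coeff (coeff p j) i)}"

definition depends_on_x :: "complex poly poly \<Rightarrow> bool" where
  "depends_on_x p \<longleftrightarrow> (\<exists>j. degree (coeff p j) > 0)"

definition depends_on_y :: "complex poly poly \<Rightarrow> bool" where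
  "depends_on_y p \<longleftrightarrow> degree p > 0"

text \<open>Irreducibility as an element of the subring \<open>R\<close>; units and factors are taken in \<open>R\<close>.\<close>

definition unit_in :: "'a::comm_semiring_1 set \<Rightarrow> 'a \<Rightarrow> bool" where
  "unit_in R a \<longleftrightarrow> a \<in> R \<and> (\<exists>b\<in>R. a * b = 1)"

definition irreducible_in :: "'a::comm_semiring_1 set \<Rightarrow> 'a \<Rightarrow> bool" where
  "irreducible_in R p \<longleftrightarrow> p \<in> R \<and> p \<noteq> 0 \<and> \<not> unit_in R p
     \<and> (\<forall>a\<in>R. \<forall>b\<in>R. p = a * b \<longrightarrow> unit_in R a \<or> unit_in R b)"

lemma irreducible_in_UNIV: "irreducible_in UNIV p \<longleftrightarrow> irreducible p"
  by (simp add: irreducible_in_def unit_in_def irreducible_def dvd_def eq_commute[of 1])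

end

theory Submission
  imports
    Defs
    "HOL-Complex_Analysis.Complex_Analysis"
    "HOL-Real_Asymp.Real_Asymp"
begin

text \<open>If \<open>w\<close> and \<open>exp w\<close> are linearly independent over the rationals, Schanuel's conjecture gives
  transcendence degree at least \<open>2\<close>, so it suffices to find a zero \<open>w\<close> of \<open>p(z, exp (exp z))\<close> with
  \<open>exp w / w\<close> not real. Such zeros lie near \<open>z = ln (2\<pi>k) + i\<pi>/2\<close> for large \<open>k\<close>: there
  \<open>exp z = 2\<pi>ik\<close> while \<open>z\<close> is almost real, and since a root \<open>y\<close> of \<open>p(z, y) = 0\<close> grows or decays only
  like a power of \<open>z\<close>, a tiny shift of \<open>z\<close> makes \<open>exp (exp z)\<close> equal to \<open>y\<close>. Rescaled at this point,
  \<open>p(z, exp (exp z))\<close> tends to \<open>P(exp s)\<close> for a nonzero polynomial \<open>P\<close> with \<open>P(1) = 0\<close>, and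
  Hurwitz's theorem provides the zero.

  For the upper bound, the rational span of the monomials of degree at most \<open>n\<close> in \<open>w\<close>, \<open>exp w\<close>,
  \<open>exp (exp w)\<close>, with coefficients in a finite-dimensional ring containing the
  coefficients of \<open>p\<close> divided by a suitable one of them, has dimension \<open>O(n\<^sup>2)\<close> because of the relation \<open>p = 0\<close>; three
  algebraically independent elements would make it grow like \<open>n\<^sup>3\<close>.\<close>

subsection \<open>Transcendence degree and growth\<close>

interpretation rat: vector_space "\<lambda>(q::rat) (z::complex). of_rat q * z"
  by unfold_locales (simp_all add: algebra_simps of_rat_add of_rat_mult)

lemma rat_span_mult:
  assumes "x \<in> rat.span A" "y \<in> rat.span B"
  shows "x * y \<in> rat.span ((\<lambda>(a, b). a * b) ` (A \<times> B))" (is "_ \<in> rat.span ?C")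
  using assms(1)
proof (induction rule: rat.span_induct_alt)
  case base
  then show ?case by (simp add: rat.span_zero)
next
  case (step c a z)
  have "a * y \<in> rat.span ?C"
    using assms(2)
  proof (induction rule: rat.span_induct_alt)
    case base
    then show ?case by (simp add: rat.span_zero)
  next
    case (step c' b z')
    have "a * b \<in> rat.span ?C"
      using step.hyps \<open>a \<in> A\<close> by (intro rat.span_base) auto
    from rat.span_add[OF rat.span_scale[OF this, of c'] step.IH] show ?case
      by (simp add: algebra_simps)
  qed
  from rat.span_add[OF rat.span_scale[OF this, of c] step.IH] show ?case
    by (simp add: algebra_simps)
qed

section \<open>Algebraic independence as linear independence of monomials\<close>

definition monomial_value :: "(complex \<Rightarrow>\<^sub>0 nat) \<Rightarrow> complex" where
  "monomial_value m = (\<Prod>a\<in>Poly_Mapping.keys m. a ^ Poly_Mapping.lookup m a)"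

text \<open>A relation among monomial values is the vanishing of the polynomial with coefficients
  \<open>c\<close> cut off outside \<open>M\<close>. So \<open>alg_indep\<close> turns into linear
  independence, and dimensions can be counted.\<close>

lemma alg_indep_sum_zero:
  assumes A: "alg_indep A" and M: "finite M" "\<And>m. m \<in> M \<Longrightarrow> Poly_Mapping.keys m \<subseteq> A"
    and 0: "(\<Sum>m\<in>M. of_rat (c m) * monomial_value m) = 0" and m: "m \<in> M"
  shows "c m = 0"
proof -
  define P where "P = Abs_poly_mapping (\<lambda>m. if m \<in> M then c m else 0)"
  have lookup: "Poly_Mapping.lookup P = (\<lambda>m. if m \<in> M then c m else 0)"
    unfolding P_def
    by (subst Abs_poly_mapping_inverse) (simp_all, rule finite_subset[OF _ M(1)], auto)
  have keys: "Poly_Mapping.keys P = {m\<in>M. c m \<noteq> 0}"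
    by (auto simp: in_keys_iff lookup split: if_splits)
  have "mpoly_eval P = (\<Sum>m\<in>M. of_rat (c m) * monomial_value m)"
    unfolding mpoly_eval_def monomial_value_def keys
    by (rule sum.mono_neutral_cong_left) (use M in \<open>auto simp: lookup\<close>)
  with A 0 have "P = 0"
    unfolding alg_indep_def using M(2) by (auto simp: keys)
  then show ?thesis
    using lookup m by (metis lookup_zero)
qed

text \<open>The factor \<open>y\<close> stands for a common denominator: monomials in field elements
  are only quotients, and multiplying them by \<open>y\<close> preserves their linear
  independence.\<close>

lemma card_le_of_alg_indep:
  assumes A: "alg_indep A" and M: "finite M" "\<And>m. m \<in> M \<Longrightarrow> Poly_Mapping.keys m \<subseteq> A"
    and y: "y \<noteq> 0" and T: "finite T" "\<And>m. m \<in> M \<Longrightarrow> y * monomial_value m \<in> rat.span T"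
  shows "card M \<le> card T"
proof -
  define v where "v m = y * monomial_value m" for m
  have zero: "c m = 0" if "(\<Sum>m\<in>M. of_rat (c m) * v m) = 0" "m \<in> M" for c m
  proof -
    have "y * (\<Sum>m\<in>M. of_rat (c m) * monomial_value m) = 0"
      using that(1) by (simp add: v_def sum_distrib_left mult_ac)
    with y have "(\<Sum>m\<in>M. of_rat (c m) * monomial_value m) = 0" by simp
    from alg_indep_sum_zero[OF A M this that(2)] show ?thesis .
  qed
  have inj: "inj_on v M"
  proof (rule inj_onI, rule ccontr)
    fix m m' assume mm: "m \<in> M" "m' \<in> M" "v m = v m'" "m \<noteq> m'"
    define c :: "_ \<Rightarrow> rat" where "c = (\<lambda>k. if k = m then 1 else if k = m' then - 1 else 0)"
    have "(\<Sum>k\<in>M. of_rat (c k) * v k) = (\<Sum>k\<in>{m, m'}. of_rat (c k) * v k)"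
      by (rule sum.mono_neutral_right) (use M mm in \<open>auto simp: c_def\<close>)
    also have "\<dots> = 0" using mm by (simp add: c_def)
    finally have "c m = 0" using zero mm by blast
    then show False by (simp add: c_def)
  qed
  have "rat.independent (v ` M)"
  proof (rule rat.independent_if_scalars_zero)
    fix f x assume "(\<Sum>x\<in>v ` M. of_rat (f x) * x) = 0" "x \<in> v ` M"
    then show "f x = 0"
      using zero[of "\<lambda>m. f (v m)"] by (auto simp: sum.reindex[OF inj])
  qed (use M in auto)
  from rat.independent_span_bound[OF T(1) this] T(2) have "card (v ` M) \<le> card T"
    by (auto simp: v_def)
  then show ?thesis by (simp add: card_image[OF inj])
qed

text \<open>Bounding each exponent, not the total degree, makes the count an exact power: such
  monomials correspond to functions from \<open>A\<close> to \<open>{..n}\<close>.\<close>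

lemma card_bounded_monomials:
  fixes A :: "'a set" and n :: nat
  assumes "finite A"
  defines "M \<equiv> {m :: 'a \<Rightarrow>\<^sub>0 nat. Poly_Mapping.keys m \<subseteq> A \<and> (\<forall>a. Poly_Mapping.lookup m a \<le> n)}"
  shows "finite M" and "card M = (n + 1) ^ card A"
proof -
  let ?g = "\<lambda>m :: 'a \<Rightarrow>\<^sub>0 nat. \<lambda>a\<in>A. Poly_Mapping.lookup m a"
  have bij: "bij_betw ?g M (A \<rightarrow>\<^sub>E {..n})"
  proof (rule bij_betw_imageI)
    show "inj_on ?g M"
    proof (rule inj_onI)
      fix m m' assume m: "m \<in> M" "m' \<in> M" "?g m = ?g m'"
      show "m = m'"
      proof (rule poly_mapping_eqI)
        fix a show "Poly_Mapping.lookup m a = Poly_Mapping.lookup m' a"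
        proof (cases "a \<in> A")
          case True
          then show ?thesis using fun_cong[OF m(3), of a] by simp
        next
          case False
          then have "a \<notin> Poly_Mapping.keys m" "a \<notin> Poly_Mapping.keys m'"
            using m by (auto simp: M_def)
          then show ?thesis by (simp add: in_keys_iff)
        qed
      qed
    qed
    show "?g ` M = (A \<rightarrow>\<^sub>E {..n})"
    proof (intro equalityI subsetI)
      fix f assume f: "f \<in> A \<rightarrow>\<^sub>E {..n}"
      define m where "m = Abs_poly_mapping (\<lambda>a. if a \<in> A then f a else 0)"
      have lookup: "Poly_Mapping.lookup m = (\<lambda>a. if a \<in> A then f a else 0)"
        unfolding m_def
        by (subst Abs_poly_mapping_inverse) (simp_all, rule finite_subset[OF _ assms(1)], auto)
      have "m \<in> M" using f by (auto simp: M_def lookup in_keys_iff split: if_splits)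
      moreover have "?g m = f" using f by (auto simp: lookup fun_eq_iff PiE_def extensional_def)
      ultimately show "f \<in> ?g ` M" by blast
    qed (auto simp: M_def)
  qed
  have "finite (A \<rightarrow>\<^sub>E {..n})" using assms(1) by (intro finite_PiE) auto
  then show "finite M" using bij_betw_finite[OF bij] by blast
  show "card M = (n + 1) ^ card A"
    using bij_betw_same_card[OF bij] assms(1) by (simp add: card_PiE)
qed

lemma monomial_value_altdef:
  assumes "finite A" "Poly_Mapping.keys m \<subseteq> A"
  shows "monomial_value m = (\<Prod>a\<in>A. a ^ Poly_Mapping.lookup m a)"
  unfolding monomial_value_def
  by (rule prod.mono_neutral_left) (use assms in \<open>auto simp: in_keys_iff\<close>)

section \<open>Filtrations of polynomial growth bound the transcendence degree\<close>

text \<open>Abstract form of "polynomial expressions of degree at most \<open>n\<close>". Growth is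
  measured by the size of spanning sets; \<open>one0\<close> supplies empty products, and
  \<open>one1\<close> makes the filtration increasing.\<close>

locale growth_filtration =
  fixes V :: "nat \<Rightarrow> complex set" and C d :: nat
  assumes subspace: "rat.subspace (V n)"
    and one0: "1 \<in> V 0" and one1: "1 \<in> V 1"
    and mult: "x \<in> V m \<Longrightarrow> y \<in> V n \<Longrightarrow> x * y \<in> V (m + n)"
    and growth: "\<exists>T. finite T \<and> card T \<le> C * (n + 1) ^ d \<and> V n \<subseteq> rat.span T"
begin

lemma mono: "m \<le> n \<Longrightarrow> V m \<subseteq> V n"
proof (induction rule: dec_induct)
  case (step n)
  moreover have "V n \<subseteq> V (Suc n)" using mult[OF _ one1] by auto
  ultimately show ?case by blast
qed auto

lemma power: "x \<in> V m \<Longrightarrow> x ^ k \<in> V (k * m)"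
  by (induction k) (use one0 mult in simp_all)

lemma prod:
  "finite A \<Longrightarrow> (\<And>a. a \<in> A \<Longrightarrow> f a \<in> V m) \<Longrightarrow> prod f A \<in> V (card A * m)"
  by (induction rule: finite_induct) (use one0 mult in simp_all)

text \<open>The quotients of filtration elements form a subfield containing \<open>S\<close>, so
  they exhaust the hull.\<close>

lemma rat_adjoin_quotient:
  assumes "S \<subseteq> V 1" "z \<in> rat_adjoin S"
  shows "\<exists>n. \<exists>x\<in>V n. \<exists>y\<in>V n. y \<noteq> 0 \<and> z = x / y"
proof -
  define K where "K = {x / y | x y n. x \<in> V n \<and> y \<in> V n \<and> y \<noteq> 0}"
  have I: "x / y \<in> K" if "x \<in> V m" "y \<in> V n" "y \<noteq> 0" for x y m n
  proof -
    have "x \<in> V (max m n)" "y \<in> V (max m n)" using that mono[of m "max m n"] mono[of n "max m n"] by auto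
    then show ?thesis using that(3) by (auto simp: K_def)
  qed
  have "is_subfield K"
    unfolding is_subfield_def
  proof (intro conjI ballI)
    show "0 \<in> K" using I[OF rat.subspace_0[OF subspace] one0] by simp
    show "1 \<in> K" using I[OF one0 one0] by simp
    fix a assume "a \<in> K"
    then obtain x y n where a: "a = x / y" "x \<in> V n" "y \<in> V n" "y \<noteq> 0" by (auto simp: K_def)
    show "- a \<in> K" using I[OF rat.subspace_neg[OF subspace a(2)] a(3,4)] a by simp
    show "inverse a \<in> K"
    \<comment> \<open>A zero numerator cannot become a denominator; this case rests on
      \<open>inverse 0 = 0\<close>.\<close>
    proof (cases "x = 0")
      case True
      then show ?thesis using a \<open>0 \<in> K\<close> by simp
    next
      case False
      then show ?thesis using I[OF a(3,2)] a by simp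
    qed
    fix b assume "b \<in> K"
    then obtain x' y' n' where b: "b = x' / y'" "x' \<in> V n'" "y' \<in> V n'" "y' \<noteq> 0"
      by (auto simp: K_def)
    show "a * b \<in> K" using I[OF mult[OF a(2) b(2)] mult[OF a(3) b(3)]] a b by simp
    have "x * y' + x' * y \<in> V (n + n')"
      using rat.subspace_add[OF subspace] mult[OF a(2) b(3)] mult[OF b(2) a(3)]
      by (metis add.commute)
    from I[OF this mult[OF a(3) b(3)]] a b show "a + b \<in> K" by (simp add: add_frac_eq)
  qed
  moreover have "S \<subseteq> K"
  proof
    fix z assume "z \<in> S"
    then show "z \<in> K" using I[of z 1 1 0] one0 assms(1) by auto
  qed
  ultimately have "rat_adjoin S \<subseteq> K"
    unfolding rat_adjoin_def by (rule hull_minimal[rotated])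
  with assms(2) have "z \<in> K" ..
  then show ?thesis unfolding K_def by blast
qed

text \<open>The product of the individual denominators serves all elements of \<open>A\<close> at
  once.\<close>

lemma common_denominator:
  assumes "S \<subseteq> V 1" "finite A" "A \<subseteq> rat_adjoin S"
  shows "\<exists>n. \<exists>y\<in>V n. y \<noteq> 0 \<and> (\<forall>a\<in>A. y * a \<in> V n)"
  using assms(2,3)
proof (induction rule: finite_induct)
  case empty
  show ?case by (intro exI[of _ 0] bexI[OF _ one0]) simp
next
  case (insert a A)
  then obtain n y where y: "y \<in> V n" "y \<noteq> 0" "\<And>a. a \<in> A \<Longrightarrow> y * a \<in> V n" by blast
  obtain n' x' y' where a: "x' \<in> V n'" "y' \<in> V n'" "y' \<noteq> 0" "a = x' / y'"
    using rat_adjoin_quotient[OF assms(1)] insert.prems by blast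
  have "y * y' * b \<in> V (n + n')" if "b \<in> insert a A" for b
  proof (cases "b = a")
    case True
    then show ?thesis using mult[OF y(1) a(1)] a by simp
  next
    case False
    then show ?thesis using mult[OF y(3) a(2), of b] that by (simp add: mult_ac)
  qed
  then show ?case using mult[OF y(1) a(2)] y(2) a(3)
    by (intro exI[of _ "n + n'"] bexI[of _ "y * y'"]) simp_all
qed

text \<open>Dimension count: there are \<open>(n + 1) ^ card A\<close> independent monomials with
  exponents at most \<open>n\<close>, and after clearing denominators they lie in a level of index
  linear in \<open>n\<close>, whose dimension is only of order \<open>n ^ d\<close>.\<close>

lemma card_alg_indep_le:
  assumes S: "S \<subseteq> V 1" and A: "finite A" "A \<subseteq> rat_adjoin S" "alg_indep A"
  shows "card A \<le> d"
proof (rule ccontr)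
  assume "\<not> card A \<le> d"
  then have d: "Suc d \<le> card A" by simp
  obtain s y where y: "y \<in> V s" "y \<noteq> 0" "\<And>a. a \<in> A \<Longrightarrow> y * a \<in> V s"
    using common_denominator[OF S A(1,2)] by blast
  \<comment> \<open>\<open>D\<close> satisfies
    \<open>card A * (n * s) + 1 \<le> D * (n + 1)\<close>. The choice of \<open>n\<close> then turns
    the bound \<open>C * (D * (n + 1)) ^ d\<close> into \<open>n * (n + 1) ^ d\<close>, just below
    \<open>(n + 1) ^ Suc d\<close>.\<close>
  define D where "D = s * card A + 1"
  define n where "n = C * D ^ d"
  define M where "M = {m :: complex \<Rightarrow>\<^sub>0 nat. Poly_Mapping.keys m \<subseteq> A
    \<and> (\<forall>a. Poly_Mapping.lookup m a \<le> n)}"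
  obtain T where T: "finite T" "card T \<le> C * (card A * (n * s) + 1) ^ d"
      "V (card A * (n * s)) \<subseteq> rat.span T"
    using growth by blast
  have "y ^ (card A * n) * monomial_value m \<in> V (card A * (n * s))" if "m \<in> M" for m
  proof -
    have m: "Poly_Mapping.keys m \<subseteq> A" "\<And>a. Poly_Mapping.lookup m a \<le> n"
      using that by (auto simp: M_def)
    have "y ^ (card A * n) * monomial_value m = (\<Prod>a\<in>A. y ^ n * a ^ Poly_Mapping.lookup m a)"
      by (simp add: monomial_value_altdef[OF A(1) m(1)] prod.distrib power_mult mult.commute)
    also have "\<dots> \<in> V (card A * (n * s))"
    proof (rule prod[OF A(1)])
      fix a assume "a \<in> A"
      let ?k = "Poly_Mapping.lookup m a"
      \<comment> \<open>Each \<open>a\<close> receives \<open>n\<close> factors \<open>y\<close>: as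
        many as its exponent clear the denominators, the others are only carried along, so the level
        does not depend on the monomial.\<close>
      have "y ^ n * a ^ ?k = y ^ (n - ?k) * (y * a) ^ ?k"
        using m(2)[of a] by (simp add: power_mult_distrib flip: power_add mult.assoc)
      moreover have "y ^ (n - ?k) * (y * a) ^ ?k \<in> V ((n - ?k) * s + ?k * s)"
        using \<open>a \<in> A\<close> y by (intro mult power) auto
      moreover have "(n - ?k) * s + ?k * s = n * s"
        using m(2)[of a] by (simp flip: add_mult_distrib)
      ultimately show "y ^ n * a ^ ?k \<in> V (n * s)" by simp
    qed
    finally show ?thesis .
  qed
  then have "card M \<le> card T"
    using card_bounded_monomials[OF A(1), of n] y(2) T
    by (intro card_le_of_alg_indep[OF A(3), of M "y ^ (card A * n)"]) (auto simp: M_def)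
  then have "(n + 1) ^ card A \<le> C * (card A * (n * s) + 1) ^ d"
    using card_bounded_monomials[OF A(1), of n] T(2) by (simp add: M_def)
  also have "\<dots> \<le> C * (D * (n + 1)) ^ d"
    by (intro mult_left_mono power_mono) (auto simp: D_def algebra_simps)
  also have "\<dots> = n * (n + 1) ^ d" by (simp only: n_def power_mult_distrib mult.assoc)
  also have "\<dots> < (n + 1) ^ Suc d" by simp
  also have "\<dots> \<le> (n + 1) ^ card A" using d by (intro power_increasing) auto
  finally show False by simp
qed

lemma trdeg_le: "S \<subseteq> V 1 \<Longrightarrow> trdeg S \<le> enat d"
  unfolding trdeg_def
proof (rule SUP_least, elim CollectE conjE)
  fix A assume "S \<subseteq> V 1" "finite A" "A \<subseteq> rat_adjoin S" "alg_indep A"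
  from card_alg_indep_le[OF this] show "enat (card A) \<le> enat d" by simp
qed

end

section \<open>Finite-dimensional coefficient rings\<close>

text \<open>Such a ring is in fact a number field. Coefficients from it cost only a constant factor
  in dimension counts; the one inverse required later is adjoined as a generator.\<close>

definition finite_dim_ring :: "complex set \<Rightarrow> bool" where
  "finite_dim_ring B \<longleftrightarrow> rat.subspace B \<and> 1 \<in> B \<and> (\<forall>x\<in>B. \<forall>y\<in>B. x * y \<in> B)
     \<and> (\<exists>T. finite T \<and> B \<subseteq> rat.span T)"

lemma rat_span_mult_closed:
  assumes "\<And>x y. x \<in> A \<Longrightarrow> y \<in> B \<Longrightarrow> x * y \<in> C" "x \<in> rat.span A" "y \<in> rat.span B"
  shows "x * y \<in> rat.span C"
proof -
  have "rat.span ((\<lambda>(a, b). a * b) ` (A \<times> B)) \<subseteq> rat.span C"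
    by (rule rat.span_mono) (use assms(1) in auto)
  then show ?thesis using rat_span_mult[OF assms(2,3)] by blast
qed

text \<open>\<open>D\<close> is the degree of an annihilating polynomial, which expresses
  \<open>b ^ D\<close> by lower powers; higher powers follow by strong induction.\<close>

lemma powers_of_algebraic_in_span:
  fixes b :: complex
  assumes "algebraic b"
  shows "\<exists>D. \<forall>n. b ^ n \<in> rat.span ((\<lambda>i. b ^ i) ` {..<D})"
proof -
  obtain P where P: "\<And>i. coeff P i \<in> \<rat>" "P \<noteq> 0" "poly P b = 0"
    using assms by (auto simp: algebraic_altdef)
  define D where "D = degree P"
  define T where "T = (\<lambda>i. b ^ i) ` {..<D}"
  have "\<forall>i. \<exists>q. coeff P i = of_rat q" using P(1) by (meson Rats_cases)
  then obtain r where r: "\<And>i. coeff P i = of_rat (r i)" by metis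
  have rD: "r D \<noteq> 0" using P(2) r[of D] by (auto simp: D_def)
  have "(\<Sum>i\<le>D. of_rat (r i) * b ^ i) = 0"
    using P(3) by (simp add: poly_altdef r D_def)
  then have "of_rat (r D) * b ^ D = - (\<Sum>i<D. of_rat (r i) * b ^ i)"
    by (simp add: lessThan_Suc_atMost[symmetric] add_eq_0_iff)
  moreover have "- (\<Sum>i<D. of_rat (r i) * b ^ i) \<in> rat.span T"
    by (intro rat.span_neg rat.span_sum rat.span_scale rat.span_base) (auto simp: T_def)
  ultimately have "of_rat (r D) * b ^ D \<in> rat.span T" by simp
  from rat.span_scale[OF this, of "inverse (r D)"] have bD: "b ^ D \<in> rat.span T"
    using rD by (simp add: of_rat_inverse flip: mult.assoc)
  have "b ^ n \<in> rat.span T" for n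
  proof (induction n rule: less_induct)
    case (less n)
    show ?case
    proof (cases "n < D")
      case True
      then show ?thesis by (intro rat.span_base) (auto simp: T_def)
    next
      case False
      \<comment> \<open>Multiplying the expression for \<open>b ^ D\<close> by
        \<open>b ^ (n - D)\<close> gives only powers below \<open>n\<close>, which the induction
        hypothesis covers.\<close>
      have sub: "x * b ^ (n - D) \<in> rat.span T" if "x \<in> rat.span T" for x
        using that
      proof (induction rule: rat.span_induct_alt)
        case base
        then show ?case by (simp add: rat.span_zero)
      next
        case (step c x y)
        then obtain i where i: "i < D" "x = b ^ i" by (auto simp: T_def)
        have "b ^ (i + (n - D)) \<in> rat.span T"
          using i False by (intro less) auto
        from rat.span_add[OF rat.span_scale[OF this, of c] step.IH] show ?case
          by (simp add: i algebra_simps power_add)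
      qed
      from sub[OF bD] False show ?thesis by (simp flip: power_add)
    qed
  qed
  then show ?thesis unfolding T_def by blast
qed

text \<open>The new ring is \<open>B[b]\<close>, spanned by products of a spanning set of
  \<open>B\<close> with finitely many powers of \<open>b\<close>.\<close>

lemma finite_dim_ring_adjoin:
  assumes B: "finite_dim_ring B" and b: "algebraic b"
  shows "\<exists>B'. finite_dim_ring B' \<and> B \<subseteq> B' \<and> b \<in> B'"
proof -
  define G where "G = {x * b ^ i | x i. x \<in> B}"
  obtain T where T: "finite T" "B \<subseteq> rat.span T" using B by (auto simp: finite_dim_ring_def)
  obtain D where D: "\<And>n. b ^ n \<in> rat.span ((\<lambda>i. b ^ i) ` {..<D})" (is "\<And>n. _ \<in> rat.span ?U")
    using powers_of_algebraic_in_span[OF b] by blast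
  have G: "x * b ^ i \<in> rat.span G" if "x \<in> B" for x i
    using that by (intro rat.span_base) (auto simp: G_def)
  have "x * y \<in> G" if xy: "x \<in> G" "y \<in> G" for x y
  proof -
    obtain u i v j where uv: "x = u * b ^ i" "y = v * b ^ j" "u \<in> B" "v \<in> B"
      using xy by (auto simp: G_def)
    have "x * y = (u * v) * b ^ (i + j)" by (simp add: uv power_add mult_ac)
    moreover have "u * v \<in> B" using B uv by (auto simp: finite_dim_ring_def)
    ultimately show ?thesis unfolding G_def by blast
  qed
  moreover have "G \<subseteq> rat.span ((\<lambda>(x, y). x * y) ` (T \<times> ?U))"
    using rat_span_mult[OF subsetD[OF T(2)] D] by (auto simp: G_def)
  then have "rat.span G \<subseteq> rat.span ((\<lambda>(x, y). x * y) ` (T \<times> ?U))"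
    by (intro rat.span_minimal rat.subspace_span)
  moreover have one: "1 \<in> B" using B by (auto simp: finite_dim_ring_def)
  ultimately have "finite_dim_ring (rat.span G)"
    unfolding finite_dim_ring_def using T(1) G[OF one, of 0]
    by (auto intro: rat.subspace_span rat_span_mult_closed
        intro!: exI[of _ "(\<lambda>(x, y). x * y) ` (T \<times> ?U)"])
  moreover have "B \<subseteq> rat.span G" "b \<in> rat.span G"
    using G[of _ 0] G[OF one, of 1] by auto
  ultimately show ?thesis by blast
qed

lemma finite_dim_ring_exists:
  assumes "finite F" "\<And>b. b \<in> F \<Longrightarrow> algebraic b"
  shows "\<exists>B. finite_dim_ring B \<and> F \<subseteq> B"
  using assms
proof (induction rule: finite_induct)
  case empty
  have "finite_dim_ring (rat.span {1})"
    unfolding finite_dim_ring_def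
    by (auto intro: rat.subspace_span rat.span_base rat_span_mult_closed[of "{1}" "{1}"])
  then show ?case by blast
next
  case (insert b F)
  then show ?case using finite_dim_ring_adjoin[of _ b] by (metis insert_iff insert_subset order_trans)
qed

section \<open>Quadratic growth from one algebraic relation\<close>

text \<open>Monomials are compared in the graded order, so that rewriting with this relation never raises
  the total degree.\<close>

lemma leading_monomial:
  fixes a c :: complex
  assumes p: "p \<noteq> 0" "\<And>i j. algebraic (coeff (coeff p j) i)" and 0: "eval2 p a c = 0"
  shows "\<exists>i k B. finite_dim_ring B \<and>
    a ^ i * c ^ k \<in> rat.span {\<beta> * (a ^ x * c ^ y) | \<beta> x y. \<beta> \<in> B \<and>
      (x + y < i + k \<or> x + y = i + k \<and> y < k)}"
proof -
  define C where "C j i = coeff (coeff p j) i" for i j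
  define N where "N = Max ((\<lambda>j. degree (coeff p j)) ` {..degree p})"
  have N: "degree (coeff p j) \<le> N" for j
  proof (cases "j \<le> degree p")
    case True
    then show ?thesis unfolding N_def by (intro Max_ge) auto
  next
    case False
    then show ?thesis by (simp add: coeff_eq_0)
  qed
  define I where "I = {..degree p} \<times> {..N}"
  have CI: "(j, i) \<in> I" if "C j i \<noteq> 0" for i j
  proof -
    have "i \<le> degree (coeff p j)" "j \<le> degree p"
      using that by (auto simp: C_def intro: le_degree)
    then show ?thesis using N[of j] by (auto simp: I_def)
  qed
  have "finite I" by (simp add: I_def)
  \<comment> \<open>\<open>J\<close> is the support of \<open>p\<close>, as pairs (exponent of
    \<open>c\<close>, exponent of \<open>a\<close>).\<close>
  define J where "J = {(j, i). C j i \<noteq> 0}"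
  have "finite J" by (rule finite_subset[OF _ \<open>finite I\<close>]) (use CI in \<open>auto simp: J_def\<close>)
  have "(degree p, degree (lead_coeff p)) \<in> J"
    using p(1) by (simp add: J_def C_def)
  then have "J \<noteq> {}" by blast
  \<comment> \<open>\<open>r\<close> is the total degree of \<open>p\<close>, and \<open>k\<close>
    below is the largest exponent of \<open>c\<close> among the terms of that degree; with
    \<open>i + k = r\<close> this singles out the leading term.\<close>
  define r where "r = Max ((\<lambda>(j, i). i + j) ` J)"
  have r: "i + j \<le> r" if "(j, i) \<in> J" for i j
    unfolding r_def using that \<open>finite J\<close> by (intro Max_ge) force+
  define K where "K = {j. \<exists>i. (j, i) \<in> J \<and> i + j = r}"
  have "K \<subseteq> fst ` J" by (force simp: K_def)
  then have "finite K" using \<open>finite J\<close> finite_surj by blast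
  have "r \<in> (\<lambda>(j, i). i + j) ` J"
    unfolding r_def using \<open>finite J\<close> \<open>J \<noteq> {}\<close> by (intro Max_in) auto
  then have "K \<noteq> {}" by (auto simp: K_def)
  define k where "k = Max K"
  have "k \<in> K" unfolding k_def using \<open>finite K\<close> \<open>K \<noteq> {}\<close> by (rule Max_in)
  then obtain i where i: "(k, i) \<in> J" "i + k = r" by (auto simp: K_def)
  have k: "j \<le> k" if "(j, i') \<in> J" "i' + j = r" for j i'
    unfolding k_def using that \<open>finite K\<close> by (intro Max_ge) (auto simp: K_def)
  \<comment> \<open>The inverse of the leading coefficient is included so that solving for the
    leading monomial keeps all coefficients in \<open>B\<close>.\<close>
  define F where "F = insert (inverse (C k i)) ((\<lambda>(j, i). C j i) ` J)"
  have "algebraic b" if "b \<in> F" for b using that p(2) by (auto simp: F_def C_def)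
  then obtain B where B: "finite_dim_ring B" "F \<subseteq> B"
    using finite_dim_ring_exists[of F] \<open>finite J\<close> unfolding F_def by blast
  let ?X = "{\<beta> * (a ^ x * c ^ y) | \<beta> x y. \<beta> \<in> B \<and> (x + y < i + k \<or> x + y = i + k \<and> y < k)}"
  have "0 = (\<Sum>j\<le>degree p. \<Sum>i\<le>N. C j i * (a ^ i * c ^ j))"
  proof -
    have "poly (coeff p j) a = (\<Sum>i\<le>N. C j i * a ^ i)" for j
      unfolding poly_altdef C_def
      by (rule sum.mono_neutral_left) (use N[of j] in \<open>auto simp: coeff_eq_0\<close>)
    then show ?thesis using 0 unfolding eval2_altdef by (simp add: sum_distrib_left mult_ac)
  qed
  also have "\<dots> = (\<Sum>(j, i)\<in>I. C j i * (a ^ i * c ^ j))"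
    by (simp add: I_def sum.cartesian_product)
  also have "\<dots> = (\<Sum>(j, i)\<in>J. C j i * (a ^ i * c ^ j))"
    by (rule sum.mono_neutral_right[OF \<open>finite I\<close>]) (use CI in \<open>auto simp: J_def\<close>)
  also have "\<dots> = C k i * (a ^ i * c ^ k) + (\<Sum>(j, i)\<in>J - {(k, i)}. C j i * (a ^ i * c ^ j))"
    by (subst sum.remove[OF \<open>finite J\<close> i(1)]) simp
  finally have "C k i * (a ^ i * c ^ k) = - (\<Sum>(j, i)\<in>J - {(k, i)}. C j i * (a ^ i * c ^ j))"
    by (simp add: eq_neg_iff_add_eq_0)
  moreover have "C k i \<noteq> 0" using i by (simp add: J_def)
  ultimately have "a ^ i * c ^ k = inverse (C k i) * - (\<Sum>(j, i)\<in>J - {(k, i)}. C j i * (a ^ i * c ^ j))"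
    by (metis (no_types, lifting) left_inverse mult.assoc mult_1)
  also have "\<dots> = - (\<Sum>(j, i')\<in>J - {(k, i)}. inverse (C k i) * C j i' * (a ^ i' * c ^ j))"
    by (simp add: sum_distrib_left case_prod_unfold mult.assoc)
  also have "\<dots> \<in> rat.span ?X"
  proof (intro rat.span_neg rat.span_sum rat.span_base)
    fix x assume "x \<in> J - {(k, i)}"
    then obtain j i' where x: "x = (j, i')" and j: "(j, i') \<in> J" "(j, i') \<noteq> (k, i)"
      by (cases x) auto
    have "i' + j < i + k \<or> i' + j = i + k \<and> j < k"
      using r[OF j(1)] k[OF j(1)] i(2) j(2) by (cases "i' + j = r") (auto simp: le_less)
    moreover have "inverse (C k i) * C j i' \<in> B"
    proof -
      have "inverse (C k i) \<in> B" "C j i' \<in> B" using B(2) j(1) by (force simp: F_def)+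
      then show ?thesis using B(1) by (auto simp: finite_dim_ring_def)
    qed
    ultimately show "(case x of (j, i') \<Rightarrow> inverse (C k i) * C j i' * (a ^ i' * c ^ j)) \<in> ?X"
      unfolding x prod.case by blast
  qed
  finally show ?thesis using B(1) by blast
qed

text \<open>Once \<open>a ^ i * c ^ k\<close> can be rewritten, only monomials with
  \<open>x < i\<close> or \<open>y < k\<close> remain, and \<open>O(n)\<close> of these have degree
  at most \<open>n\<close>. Powers of \<open>b\<close> contribute another factor
  \<open>n + 1\<close>, so the growth is quadratic.\<close>

lemma trdeg_le_2:
  fixes a b c :: complex
  assumes p: "p \<noteq> 0" "\<And>i j. algebraic (coeff (coeff p j) i)" and 0: "eval2 p a c = 0"
  shows "trdeg {a, b, c} \<le> 2"
proof -
  obtain i k B where B: "finite_dim_ring B" and lead: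
    "a ^ i * c ^ k \<in> rat.span {\<beta> * (a ^ x * c ^ y) | \<beta> x y. \<beta> \<in> B \<and>
      (x + y < i + k \<or> x + y = i + k \<and> y < k)}"
    (is "_ \<in> rat.span ?X")
    using leading_monomial[OF p 0] by blast
  obtain T where T: "finite T" "B \<subseteq> rat.span T" using B by (auto simp: finite_dim_ring_def)
  have B1: "1 \<in> B" and Bm: "\<And>x y. x \<in> B \<Longrightarrow> y \<in> B \<Longrightarrow> x * y \<in> B"
    using B by (auto simp: finite_dim_ring_def)
  define W where "W n = {\<beta> * (a ^ x * c ^ y) | \<beta> x y. \<beta> \<in> B \<and> x + y \<le> n \<and> (x < i \<or> y < k)}" for n
  \<comment> \<open>Induction on total degree, then on the exponent of \<open>c\<close>. Multiplying
    the leading relation by the cofactor \<open>a ^ (x - i) * c ^ (y - k)\<close> yields only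
    smaller terms, still of degree at most \<open>n\<close>.\<close>
  have reduce: "\<beta> * (a ^ x * c ^ y) \<in> rat.span (W n)" if "\<beta> \<in> B" "x + y \<le> n" for \<beta> x y n
    using that
  proof (induction "(x + y, y)" arbitrary: \<beta> x y rule: wf_induct_rule[OF wf_lex_prod[OF wf_less_than wf_less_than]])
    case (1 x y)
    show ?case
    proof (cases "x < i \<or> y < k")
      case True
      then show ?thesis using 1 by (intro rat.span_base) (auto simp: W_def)
    next
      case False
      have "\<beta> * (a ^ (x - i) * c ^ (y - k)) * z \<in> rat.span (W n)" if "z \<in> rat.span ?X" for z
        using that
      proof (induction rule: rat.span_induct_alt)
        case base
        then show ?case by (simp add: rat.span_zero)
      next
        case (step q z z')
        then obtain \<gamma> x' y' where z: "z = \<gamma> * (a ^ x' * c ^ y')" "\<gamma> \<in> B"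
          "x' + y' < i + k \<or> x' + y' = i + k \<and> y' < k" by blast
        have "\<beta> * \<gamma> * (a ^ (x - i + x') * c ^ (y - k + y')) \<in> rat.span (W n)"
          using False z(3) 1(3) Bm[OF 1(2) z(2)] by (intro 1(1)) auto
        from rat.span_add[OF rat.span_scale[OF this, of q] step.IH] show ?case
          by (simp add: z(1) algebra_simps power_add)
      qed
      from this[OF lead]
      have "\<beta> * ((a ^ (x - i) * a ^ i) * (c ^ (y - k) * c ^ k)) \<in> rat.span (W n)"
        by (simp add: mult_ac)
      then show ?thesis using False by (simp flip: power_add)
    qed
  qed
  define G where "G n = {\<beta> * (a ^ x * c ^ y) * b ^ z | \<beta> x y z. \<beta> \<in> B \<and> x + y \<le> n \<and> z \<le> n}" for n
  define C where "C = card T * (i + k)"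
  have G1: "g \<in> rat.span (G n)" if "g = 1 * (a ^ x * c ^ y) * b ^ z" "x + y \<le> n" "z \<le> n" for g x y z n
    using that B1 by (intro rat.span_base) (unfold G_def, blast)
  interpret growth_filtration "\<lambda>n. rat.span (G n)" C 2
  proof
    show "1 \<in> rat.span (G 0)" by (rule G1[of _ 0 0 0]) auto
    show "1 \<in> rat.span (G 1)" by (rule G1[of _ 0 0 0]) auto
    show "x * y \<in> rat.span (G (m + n))" if "x \<in> rat.span (G m)" "y \<in> rat.span (G n)" for x y m n
    proof (rule rat_span_mult_closed[OF _ that])
      fix x y assume "x \<in> G m" "y \<in> G n"
      then obtain \<beta> u v w \<beta>' u' v' w' where
        x: "x = \<beta> * (a ^ u * c ^ v) * b ^ w" "\<beta> \<in> B" "u + v \<le> m" "w \<le> m" and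
        y: "y = \<beta>' * (a ^ u' * c ^ v') * b ^ w'" "\<beta>' \<in> B" "u' + v' \<le> n" "w' \<le> n"
        by (auto simp: G_def)
      have "x * y = \<beta> * \<beta>' * (a ^ (u + u') * c ^ (v + v')) * b ^ (w + w')"
        by (simp add: x y power_add mult_ac)
      moreover have "u + u' + (v + v') \<le> m + n" "w + w' \<le> m + n" using x y by auto
      ultimately show "x * y \<in> G (m + n)" unfolding G_def using Bm[OF x(2) y(2)] by blast
    qed
    fix n
    \<comment> \<open>Two strips of widths \<open>i\<close> and \<open>k\<close> contain all reduced
      exponent pairs; this is the source of the factor \<open>i + k\<close> in
      \<open>C\<close>.\<close>
    define R where "R = {..<i} \<times> {..n} \<union> {..n} \<times> {..<k}"
    define f where "f = (\<lambda>(t, (x, y), z). t * (a ^ x * c ^ y) * b ^ z)"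
    define U where "U = f ` (T \<times> R \<times> {..n})"
    have "card R \<le> i * (n + 1) + (n + 1) * k"
      unfolding R_def using card_Un_le[of "{..<i} \<times> {..n}" "{..n} \<times> {..<k}"]
      by (simp add: card_cartesian_product)
    have "card U \<le> card T * (card R * (n + 1))"
      unfolding U_def using T(1) card_image_le[of "T \<times> R \<times> {..n}" f]
      by (simp add: card_cartesian_product R_def)
    also have "\<dots> \<le> card T * ((i * (n + 1) + (n + 1) * k) * (n + 1))"
      by (intro mult_left_mono mult_right_mono \<open>card R \<le> _\<close>) auto
    also have "\<dots> = C * (n + 1) ^ 2" by (simp add: C_def power2_eq_square algebra_simps)
    finally have "card U \<le> C * (n + 1) ^ 2" .
    have WU: "w * b ^ z \<in> rat.span U" if "w \<in> rat.span (W n)" "z \<le> n" for w z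
      using that(1)
    proof (induction rule: rat.span_induct_alt)
      case base
      then show ?case by (simp add: rat.span_zero)
    next
      case (step q w w')
      then obtain \<beta> x y where w: "w = \<beta> * (a ^ x * c ^ y)" "\<beta> \<in> B" "x + y \<le> n" "x < i \<or> y < k"
        by (auto simp: W_def)
      have "\<beta> * (a ^ x * c ^ y * b ^ z) \<in> rat.span U"
      proof (rule rat_span_mult_closed)
        show "\<beta> \<in> rat.span T" using T w by auto
        show "a ^ x * c ^ y * b ^ z \<in> rat.span {a ^ x * c ^ y * b ^ z}"
          by (rule rat.span_base) simp
        fix t s assume "t \<in> T" "s \<in> {a ^ x * c ^ y * b ^ z}"
        then have "t * s = f (t, (x, y), z)" "(t, (x, y), z) \<in> T \<times> R \<times> {..n}"
          using w that(2) by (auto simp: f_def R_def mult_ac)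
        then show "t * s \<in> U" unfolding U_def by (metis image_eqI)
      qed
      from rat.span_add[OF rat.span_scale[OF this, of q] step.IH] show ?case
        by (simp add: w(1) algebra_simps)
    qed
    have "G n \<subseteq> rat.span U"
      using reduce WU by (auto simp: G_def)
    then have "rat.span (G n) \<subseteq> rat.span U" by (intro rat.span_minimal rat.subspace_span)
    moreover have "finite U" using T(1) by (simp add: U_def R_def)
    ultimately show "\<exists>T. finite T \<and> card T \<le> C * (n + 1)\<^sup>2 \<and> rat.span (G n) \<subseteq> rat.span T"
      using \<open>card U \<le> C * (n + 1) ^ 2\<close> by blast
  qed (rule rat.subspace_span)
  have "{a, b, c} \<subseteq> rat.span (G 1)"
    using G1[of a 1 0 0 1] G1[of b 0 0 1 1] G1[of c 0 1 0 1] by simp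
  from trdeg_le[OF this] show ?thesis by (simp add: numeral_eq_enat)
qed

subsection \<open>Zeros of \<open>p(z, exp (exp z))\<close>\<close>

text \<open>The product with a principal filter encodes uniformity over \<open>S\<close>, so uniform
  limits can be computed with the ordinary limit rules.\<close>

lemma eventually_prod_principal:
  "eventually P (F \<times>\<^sub>F principal S) \<longleftrightarrow> (\<forall>\<^sub>F x in F. \<forall>y\<in>S. P (x, y))"
proof
  assume "eventually P (F \<times>\<^sub>F principal S)"
  then obtain Pf Pg where "eventually Pf F" "eventually Pg (principal S)"
    "\<And>x y. Pf x \<Longrightarrow> Pg y \<Longrightarrow> P (x, y)"
    unfolding eventually_prod_filter by blast
  then show "\<forall>\<^sub>F x in F. \<forall>y\<in>S. P (x, y)"
    by (auto simp: eventually_principal elim: eventually_mono)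
next
  assume "\<forall>\<^sub>F x in F. \<forall>y\<in>S. P (x, y)"
  then show "eventually P (F \<times>\<^sub>F principal S)"
    unfolding eventually_prod_filter
    by (intro exI[of _ "\<lambda>x. \<forall>y\<in>S. P (x, y)"] exI[of _ "\<lambda>y. y \<in> S"]) (auto simp: eventually_principal)
qed

lemma uniform_limit_prod_principalI:
  fixes f :: "'a \<Rightarrow> 'b \<Rightarrow> 'c :: real_normed_vector"
  assumes "((\<lambda>(n, x). f n x - l x) \<longlongrightarrow> 0) (F \<times>\<^sub>F principal S)"
  shows "uniform_limit S f l F"
  using assms unfolding tendsto_iff uniform_limit_iff
  by (simp add: eventually_prod_principal dist_norm)

lemma tendsto_prod_fst: "(f \<longlongrightarrow> l) F \<Longrightarrow> ((\<lambda>t. f (fst t)) \<longlongrightarrow> l) (F \<times>\<^sub>F G)"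
  by (rule filterlim_compose[OF _ filterlim_fst])

text \<open>Near infinity \<open>q\<close> behaves like its leading term, for which the ratio is
  \<open>(1 + e t / x t) ^ degree q\<close>.\<close>

lemma poly_shift_ratio_tendsto:
  fixes q :: "complex poly"
  assumes q: "q \<noteq> 0" and x: "filterlim x at_infinity F" and e: "(e \<longlongrightarrow> 0) F"
  shows "((\<lambda>t. poly q (x t + e t) / poly q (x t)) \<longlongrightarrow> 1) F"
proof -
  define A where "A y = poly q y / y ^ degree q" for y
  have xe: "filterlim (\<lambda>t. x t + e t) at_infinity F"
    by (rule tendsto_add_filterlim_at_infinity'[OF x e])
  have A: "(A \<longlongrightarrow> lead_coeff q) at_infinity"
    unfolding A_def by (rule poly_divide_tendsto_aux)
  have "((\<lambda>t. A (x t + e t) / A (x t) * (1 + e t / x t) ^ degree q)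
      \<longlongrightarrow> lead_coeff q / lead_coeff q * (1 + 0) ^ degree q) F"
    using q by (intro tendsto_intros filterlim_compose[OF A] x xe tendsto_divide_0[OF e x]) auto
  moreover have "\<forall>\<^sub>F t in F. A (x t + e t) / A (x t) * (1 + e t / x t) ^ degree q
      = poly q (x t + e t) / poly q (x t)"
    using filterlim_at_infinity_imp_eventually_ne[OF x, of 0]
      filterlim_at_infinity_imp_eventually_ne[OF xe, of 0]
  proof eventually_elim
    case (elim t)
    have "1 + e t / x t = (x t + e t) / x t" using elim by (simp add: field_simps)
    then show ?case using elim by (simp add: A_def power_divide)
  qed
  ultimately show ?thesis using q by (simp add: filterlim_cong)
qed

section \<open>Bounds for roots and their logarithms\<close>

text \<open>A Cauchy-type bound: if \<open>norm y > 1\<close>, solve for \<open>y ^ n\<close> and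
  cancel \<open>norm y ^ (n - 1)\<close>.\<close>

lemma norm_poly_root_le:
  fixes b :: "nat \<Rightarrow> complex"
  assumes "(\<Sum>i\<le>n. b i * y ^ i) = 0" "b n \<noteq> 0"
  shows "norm y \<le> 1 + (\<Sum>i<n. norm (b i / b n))"
proof (cases "norm y \<le> 1")
  case True
  then show ?thesis by (smt (verit) norm_ge_zero sum_nonneg)
next
  case False
  have "n \<noteq> 0" using assms by (intro notI) simp
  then obtain m where n: "n = Suc m" using not0_implies_Suc by blast
  have "b n * y ^ n = - (\<Sum>i<n. b i * y ^ i)"
    using assms(1) by (simp add: lessThan_Suc_atMost[symmetric] add_eq_0_iff)
  then have "y ^ n = - (\<Sum>i<n. b i / b n * y ^ i)"
    using assms(2) by (simp add: field_simps sum_divide_distrib[symmetric])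
  then have "norm y ^ n = norm (\<Sum>i<n. b i / b n * y ^ i)"
    by (metis norm_minus_cancel norm_power)
  also have "\<dots> \<le> (\<Sum>i<n. norm (b i / b n) * norm y ^ m)"
  proof (rule sum_norm_le)
    fix i assume "i \<in> {..<n}"
    then have "norm y ^ i \<le> norm y ^ m" using False n by (intro power_increasing) auto
    then show "norm (b i / b n * y ^ i) \<le> norm (b i / b n) * norm y ^ m"
      unfolding norm_mult norm_power by (intro mult_left_mono) auto
  qed
  also have "\<dots> = (\<Sum>i<n. norm (b i / b n)) * norm y ^ m" by (simp add: sum_distrib_right)
  finally have "norm y * norm y ^ m \<le> (\<Sum>i<n. norm (b i / b n)) * norm y ^ m"
    by (simp add: n)
  moreover have "norm y ^ m > 0" using False by (intro zero_less_power) linarith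
  ultimately have "norm y \<le> (\<Sum>i<n. norm (b i / b n))" by (rule mult_right_le_imp_le)
  then show ?thesis by simp
qed

text \<open>\<open>inverse y\<close> is a root of the polynomial with reversed coefficients.\<close>

lemma norm_inverse_poly_root_le:
  fixes b :: "nat \<Rightarrow> complex" and n :: nat
  assumes "(\<Sum>i\<le>n. b i * y ^ i) = 0" "b 0 \<noteq> 0" "y \<noteq> 0"
  shows "norm (inverse y) \<le> 1 + (\<Sum>i<n. norm (b (n - i) / b 0))"
proof -
  have "(\<Sum>i\<le>n. b (n - i) * inverse y ^ i) = (\<Sum>i\<le>n. b i * inverse y ^ (n - i))"
    by (rule sum.reindex_bij_witness[of _ "\<lambda>i. n - i" "\<lambda>i. n - i"]) auto
  also have "\<dots> = (\<Sum>i\<le>n. inverse y ^ n * (b i * y ^ i))"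
    using assms(3) by (intro sum.cong) (auto simp: power_diff power_inverse field_simps)
  also have "\<dots> = 0" using assms(1) by (simp flip: sum_distrib_left)
  finally show ?thesis
    using norm_poly_root_le[where b = "\<lambda>i. b (n - i)" and y = "inverse y" and n = n] assms(2) by simp
qed

text \<open>Crude but sufficient: at the centres the roots and their inverses are bounded by powers
  of \<open>ln k\<close>, and the logarithm only has to be small compared with
  \<open>k\<close>.\<close>

lemma norm_Ln_le:
  assumes "z \<noteq> 0"
  shows "norm (Ln z) \<le> norm z + norm (inverse z) + pi"
proof -
  have "norm (Ln z) \<le> \<bar>Re (Ln z)\<bar> + \<bar>Im (Ln z)\<bar>" by (rule cmod_le)
  moreover have "\<bar>Im (Ln z)\<bar> \<le> pi"
    using Im_Ln_le_pi[OF assms] mpi_less_Im_Ln[OF assms] by linarith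
  moreover have "\<bar>ln (norm z)\<bar> \<le> norm z + norm (inverse z)"
  proof -
    have "ln (norm z) \<le> norm z" "ln (norm (inverse z)) \<le> norm (inverse z)"
      using assms ln_le_minus_one[of "norm z"] ln_le_minus_one[of "norm (inverse z)"] by auto
    moreover have "ln (norm (inverse z)) = - ln (norm z)"
      using assms by (simp add: norm_inverse ln_inverse)
    ultimately show ?thesis using norm_ge_zero[of z] norm_ge_zero[of "inverse z"] by linarith
  qed
  ultimately show ?thesis using assms by simp
qed

lemma finite_family_convergent_subsequence:
  fixes d :: "nat \<Rightarrow> nat \<Rightarrow> complex"
  assumes "\<And>k i. norm (d k i) \<le> 1"
  shows "\<exists>D r. strict_mono r \<and> (\<forall>i<n. (\<lambda>k. d (r k) i) \<longlonglongrightarrow> D i)"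
proof (induction n)
  case 0
  show ?case using strict_mono_id by auto
next
  case (Suc n)
  then obtain D r where r: "strict_mono r" "\<And>i. i < n \<Longrightarrow> (\<lambda>k. d (r k) i) \<longlonglongrightarrow> D i" by blast
  have "seq_compact (cball 0 1 :: complex set)" by (simp add: compact_eq_seq_compact_metric[symmetric])
  then obtain l r' where r': "strict_mono r'" "((\<lambda>k. d (r k) n) \<circ> r') \<longlonglongrightarrow> l"
    unfolding seq_compact_def using assms by (metis mem_cball_0)
  have "(\<lambda>k. d ((r \<circ> r') k) i) \<longlonglongrightarrow> (D(n := l)) i" if "i < Suc n" for i
    using LIMSEQ_subseq_LIMSEQ[OF r(2) r'(1), of i] r'(2) that
    by (cases "i = n") (auto simp: o_def)
  then show ?case using strict_mono_o[OF r(1) r'(1)] by blast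
qed

section \<open>The centres and the roots above them\<close>

text \<open>Chosen so that \<open>exp (centre k)\<close> is \<open>2 * pi * k * \<i>\<close>, whence
  \<open>exp (exp (centre k)) = 1\<close>, while the imaginary part stays bounded.\<close>

definition centre :: "nat \<Rightarrow> complex" where
  "centre k = of_real (ln (2 * pi * k)) + \<i> * of_real (pi / 2)"

lemma exp_centre:
  assumes "k > 0"
  shows "exp (centre k) = of_real (2 * pi * k) * \<i>"
proof -
  have "exp (\<i> * of_real (pi / 2)) = \<i>"
    by (simp only: cis_conv_exp[symmetric] cis_pi_half)
  moreover have "exp (of_real (ln (2 * pi * k)) :: complex) = of_real (2 * pi * k)"
    using assms by (simp only: exp_of_real) (simp add: exp_ln)
  ultimately show ?thesis unfolding centre_def exp_add by simp
qed

lemma filterlim_centre: "filterlim centre at_infinity sequentially"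
proof -
  have "filterlim (\<lambda>k. ln (2 * pi * real k)) at_infinity sequentially" by real_asymp
  then have "filterlim (\<lambda>k. of_real (ln (2 * pi * real k)) :: complex) at_infinity sequentially"
    by (simp add: filterlim_at_infinity_conv_norm_at_top)
  then show ?thesis unfolding centre_def
    by (rule tendsto_add_filterlim_at_infinity'[OF _ tendsto_const])
qed

lemma centre_power_over: "(\<lambda>k. centre k ^ m / of_nat k) \<longlonglongrightarrow> 0"
proof (rule Lim_null_comparison)
  \<comment> \<open>The summand 2 bounds the imaginary part \<open>pi / 2\<close>.\<close>
  show "(\<lambda>k. (ln (2 * pi * real k) + 2) ^ m / real k) \<longlonglongrightarrow> 0"
    by real_asymp
  have "norm (centre k ^ m / of_nat k) \<le> (ln (2 * pi * real k) + 2) ^ m / real k" if "k > 0" for k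
  proof -
    have "2 * pi * real k \<ge> 1" using that pi_ge_two
      by (smt (verit) mult_le_cancel_left1 of_nat_0_less_iff of_nat_le_iff One_nat_def Suc_leI of_nat_1)
    then have "ln (2 * pi * real k) \<ge> 0" by (rule ln_ge_zero)
    then have "norm (centre k) \<le> ln (2 * pi * real k) + 2"
      unfolding centre_def using pi_less_4
      by (intro norm_triangle_le add_mono) (auto simp: norm_mult)
    then show ?thesis
      by (auto simp: norm_divide norm_power intro!: divide_right_mono power_mono)
  qed
  then show "\<forall>\<^sub>F k in sequentially. norm (centre k ^ m / of_nat k)
      \<le> (ln (2 * pi * real k) + 2) ^ m / real k"
    by (intro eventually_mono[OF eventually_gt_at_top[of 0]]) auto
qed

text \<open>A power of the centre is moved into the denominator to make the rational function
  proper; the compensating power, divided by \<open>k\<close>, still tends to zero.\<close>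

lemma poly_quotient_centre_over:
  assumes "q \<noteq> 0"
  shows "(\<lambda>k. norm (poly p (centre k) / poly q (centre k)) / real k) \<longlonglongrightarrow> 0"
proof -
  define m where "m = Suc (degree p)"
  let ?f = "\<lambda>k. poly p (centre k) / poly (q * monom 1 m) (centre k) * (centre k ^ m / of_nat k)"
  have "degree (q * monom 1 m) > degree p"
    using assms by (simp add: degree_mult_eq degree_monom_eq monom_eq_0_iff m_def)
  then have "?f \<longlonglongrightarrow> 0 * 0"
    by (intro tendsto_intros filterlim_compose[OF poly_divide_tendsto_0_at_infinity filterlim_centre]
        centre_power_over)
  moreover have "\<forall>\<^sub>F k in sequentially.
      ?f k = poly p (centre k) / poly q (centre k) / of_nat k"
    using filterlim_at_infinity_imp_eventually_ne[OF filterlim_centre, of 0]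
    by eventually_elim (auto simp: poly_monom)
  ultimately have "(\<lambda>k. poly p (centre k) / poly q (centre k) / of_nat k) \<longlonglongrightarrow> 0"
    by (simp add: filterlim_cong)
  from tendsto_norm_zero[OF this] show ?thesis by (simp add: norm_divide norm_mult)
qed

text \<open>The filter is \<open>nhds 0\<close>, not \<open>at 0\<close>, because the increment
  vanishes at the middle of the disc; there division by zero gives the correct value 0.\<close>

lemma exp_minus_one_over_tendsto: "((\<lambda>h::complex. (exp h - 1 - h) / h) \<longlongrightarrow> 0) (nhds 0)"
proof -
  have "((\<lambda>h::complex. (exp (0 + h) - exp 0) / h - 1) \<longlongrightarrow> exp 0 - 1) (at 0)"
    by (intro tendsto_intros DERIV_D DERIV_exp)
  moreover have "\<forall>\<^sub>F h::complex in at 0. (exp (0 + h) - exp 0) / h - 1 = (exp h - 1 - h) / h"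
    by (auto simp: eventually_at_filter field_simps)
  ultimately have "((\<lambda>h::complex. (exp h - 1 - h) / h) \<longlongrightarrow> 0) (at 0)"
    by (simp add: filterlim_cong)
  then show ?thesis
    using tendsto_at_iff_tendsto_nhds[of "\<lambda>h::complex. (exp h - 1 - h) / h" 0] by simp
qed

lemma poly_centre_nonzero:
  assumes "q \<noteq> 0"
  shows "\<forall>\<^sub>F k in sequentially. poly q (centre k) \<noteq> 0"
proof -
  \<comment> \<open>Without a shift the ratio is 1, or 0 at a zero of \<open>q\<close> since
    \<open>0 / 0 = 0\<close>; its limit 1 excludes zeros eventually.\<close>
  have "((\<lambda>k. poly q (centre k + 0) / poly q (centre k)) \<longlongrightarrow> 1) sequentially"
    by (rule poly_shift_ratio_tendsto[OF assms filterlim_centre tendsto_const])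
  then have "\<forall>\<^sub>F k in sequentially. poly q (centre k + 0) / poly q (centre k) \<noteq> 0"
    by (rule tendsto_imp_eventually_ne) simp
  then show ?thesis by eventually_elim auto
qed

text \<open>The leading coefficient survives specialisation, so a root exists over the complex
  numbers; the constant coefficient survives too, so the root is not 0.\<close>

lemma specialised_root_exists:
  fixes p :: "complex poly poly"
  assumes "poly (coeff p 0) x \<noteq> 0" "poly (lead_coeff p) x \<noteq> 0" "degree p > 0"
  shows "\<exists>y. y \<noteq> 0 \<and> eval2 p x y = 0"
proof -
  define P where "P = map_poly (\<lambda>c. poly c x) p"
  have P: "coeff P i = poly (coeff p i) x" for i
    by (simp add: P_def coeff_map_poly)
  have "degree P = degree p"
  proof (rule antisym)
    show "degree P \<le> degree p" by (rule degree_le) (simp add: P coeff_eq_0)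
    show "degree p \<le> degree P" by (rule le_degree) (use assms(2) in \<open>simp add: P\<close>)
  qed
  then obtain y where "poly P y = 0" using alg_closed_imp_poly_has_root assms(3) by metis
  then have "eval2 p x y = 0" "y \<noteq> 0"
    using assms(1) \<open>degree P = degree p\<close> P[of 0]
    by (auto simp: eval2_altdef poly_altdef[of P] P poly_0_coeff_0)
  then show ?thesis by blast
qed

text \<open>Both root bounds are sums of rational functions of \<open>centre k\<close>, hence
  \<open>o(k)\<close>, and so is the logarithm of the root.\<close>

lemma roots_above_centres:
  fixes p :: "complex poly poly"
  assumes p: "coeff p 0 \<noteq> 0" "degree p > 0"
  shows "\<exists>Y. (\<forall>\<^sub>F k in sequentially. Y k \<noteq> 0 \<and> eval2 p (centre k) (Y k) = 0)
    \<and> (\<lambda>k. Ln (Y k) / (of_real (2 * pi * real k) * \<i>)) \<longlonglongrightarrow> 0"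
proof -
  define n where "n = degree p"
  define b where "b k i = poly (coeff p i) (centre k)" for k i
  have pn: "coeff p n \<noteq> 0" using p(2) by (auto simp: n_def)
  have b: "\<forall>\<^sub>F k in sequentially. b k 0 \<noteq> 0 \<and> b k n \<noteq> 0"
    unfolding b_def by (intro eventually_conj poly_centre_nonzero p pn)
  define Y where "Y k = (SOME y. y \<noteq> 0 \<and> eval2 p (centre k) y = 0)" for k
  from b have Y: "\<forall>\<^sub>F k in sequentially. Y k \<noteq> 0 \<and> eval2 p (centre k) (Y k) = 0"
  proof eventually_elim
    case (elim k)
    then have "\<exists>y. y \<noteq> 0 \<and> eval2 p (centre k) y = 0"
      using p(2) by (intro specialised_root_exists) (simp_all add: b_def n_def)
    then show ?case unfolding Y_def by (rule someI_ex)
  qed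
  have "(\<lambda>k. Ln (Y k) / (of_real (2 * pi * real k) * \<i>)) \<longlonglongrightarrow> 0"
  proof (rule Lim_null_comparison)
    let ?B = "\<lambda>k. (\<Sum>i<n. norm (b k i / b k n) / real k) + (\<Sum>i<n. norm (b k (n - i) / b k 0) / real k)
      + (2 + pi) / real k"
    have "?B \<longlonglongrightarrow> (\<Sum>i<n. 0) + (\<Sum>i<n. 0) + 0"
      unfolding b_def using pn p(1)
      by (intro tendsto_add tendsto_sum poly_quotient_centre_over) (auto intro: lim_const_over_n)
    then show "?B \<longlonglongrightarrow> 0" by simp
    show "\<forall>\<^sub>F k in sequentially. norm (Ln (Y k) / (of_real (2 * pi * real k) * \<i>)) \<le> ?B k"
      using b Y eventually_gt_at_top[of 0]
    proof eventually_elim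
      case (elim k)
      have sum: "(\<Sum>i\<le>n. b k i * Y k ^ i) = 0"
        using elim by (simp add: eval2_altdef b_def n_def)
      have "norm (Ln (Y k)) \<le> norm (Y k) + norm (inverse (Y k)) + pi"
        by (rule norm_Ln_le) (use elim in auto)
      also have "\<dots> \<le> (1 + (\<Sum>i<n. norm (b k i / b k n))) + (1 + (\<Sum>i<n. norm (b k (n - i) / b k 0))) + pi"
        using sum elim by (intro add_mono norm_poly_root_le norm_inverse_poly_root_le) auto
      finally have "norm (Ln (Y k)) / real k \<le>
          ((1 + (\<Sum>i<n. norm (b k i / b k n))) + (1 + (\<Sum>i<n. norm (b k (n - i) / b k 0))) + pi) / real k"
        by (intro divide_right_mono) auto
      also have "\<dots> = ?B k" by (simp add: add_divide_distrib sum_divide_distrib)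
      finally have *: "norm (Ln (Y k)) / real k \<le> ?B k" .
      have "1 * real k \<le> 2 * pi * real k"
        using pi_ge_two by (intro mult_right_mono) linarith+
      then have "norm (Ln (Y k) / (of_real (2 * pi * real k) * \<i>)) \<le> norm (Ln (Y k)) / real k"
        using elim unfolding norm_divide norm_mult
        by (intro divide_left_mono) (auto simp: norm_mult)
      with * show ?case by linarith
    qed
  qed
  with Y show ?thesis by blast
qed

section \<open>Existence of the zero by Hurwitz's theorem\<close>

text \<open>The condition on \<open>exp w / w\<close> secures linear independence of
  \<open>w\<close> and \<open>exp w\<close>. If no such zero existed, the rescaled functions
  \<open>H\<close> would be zero-free on the unit disc, and so would their nonconstant limit
  \<open>G\<close>, although \<open>G 0 = 0\<close>.\<close>

lemma exists_zero_off_real_lines: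
  fixes p :: "complex poly poly"
  assumes p: "coeff p 0 \<noteq> 0" "degree p > 0"
  shows "\<exists>w. eval2 p w (exp (exp w)) = 0 \<and> Im (exp w / w) \<noteq> 0"
proof (rule ccontr)
  assume no: "\<not> ?thesis"
  define n where "n = degree p"
  obtain Y where Y: "\<forall>\<^sub>F k in sequentially. Y k \<noteq> 0 \<and> eval2 p (centre k) (Y k) = 0"
    and Y0: "(\<lambda>k. Ln (Y k) / (of_real (2 * pi * real k) * \<i>)) \<longlonglongrightarrow> 0"
    using roots_above_centres[OF p] by blast
  define \<delta> where "\<delta> k = Ln (Y k) / (of_real (2 * pi * real k) * \<i>)" for k
  \<comment> \<open>This solves \<open>exp (z k) = 2 * pi * k * \<i> + Ln (Y k)\<close>, so that
    \<open>exp (exp (z k)) = Y k\<close>.\<close>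
  define z where "z k = centre k + Ln (1 + \<delta> k)" for k
  define \<Lambda> where "\<Lambda> k = exp (z k)" for k
  define b where "b k i = poly (coeff p i) (centre k) * Y k ^ i" for k i
  \<comment> \<open>Dividing by \<open>M\<close> gives the terms of \<open>p\<close> at
    \<open>(centre k, Y k)\<close> total absolute value 1, which keeps the limit from vanishing
    identically.\<close>
  define M where "M k = (\<Sum>i\<le>n. norm (b k i))" for k
  \<comment> \<open>Moving \<open>z k\<close> by \<open>s / \<Lambda> k\<close> moves its
    exponential by about \<open>s\<close>, hence multiplies the double exponential by about
    \<open>exp s\<close>.\<close>
  define H where "H k s = eval2 p (z k + s / \<Lambda> k) (exp (exp (z k + s / \<Lambda> k))) / of_real (M k)" for k s
  define F where "F = sequentially \<times>\<^sub>F principal (ball (0::complex) 1)"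
  have \<delta>0: "\<delta> \<longlonglongrightarrow> 0" using Y0 unfolding \<delta>_def .
  then have \<delta>1: "(\<lambda>k. 1 + \<delta> k) \<longlonglongrightarrow> 1" by (auto intro!: tendsto_eq_intros)
  have \<delta>ne: "\<forall>\<^sub>F k in sequentially. 1 + \<delta> k \<noteq> 0"
    by (rule tendsto_imp_eventually_ne[OF \<delta>1]) simp
  have \<Lambda>: "\<forall>\<^sub>F k in sequentially. \<Lambda> k = of_real (2 * pi * real k) * \<i> * (1 + \<delta> k)"
    using \<delta>ne eventually_gt_at_top[of 0]
    by eventually_elim (simp add: \<Lambda>_def z_def exp_add exp_centre)
  have exp\<Lambda>: "\<forall>\<^sub>F k in sequentially. exp (\<Lambda> k) = Y k"
    using \<Lambda> Y eventually_gt_at_top[of 0]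
  proof eventually_elim
    case (elim k)
    have "\<Lambda> k = of_real (2 * pi * real k) * \<i> + Ln (Y k)"
      using elim by (simp add: \<delta>_def distrib_left)
    moreover have "exp (of_real (2 * pi * real k) * \<i>) = 1"
      by (rule exp_integer_2pi[of "of_nat k", THEN trans[rotated]]) (auto simp: mult_ac)
    ultimately show ?case using elim by (simp add: exp_add)
  qed
  have \<Lambda>_inf: "filterlim \<Lambda> at_infinity sequentially"
  proof -
    have "filterlim (\<lambda>k. norm (of_real (2 * pi * real k) * \<i> :: complex)) at_top sequentially"
      unfolding norm_mult norm_of_real norm_ii by real_asymp
    then have "filterlim (\<lambda>k. (1 + \<delta> k) * (of_real (2 * pi * real k) * \<i>)) at_infinity sequentially"
      by (intro tendsto_mult_filterlim_at_infinity[OF \<delta>1] filterlim_norm_at_top_imp_at_infinity) auto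
    then show ?thesis
      by (rule filterlim_mono_eventually) (use \<Lambda> in \<open>auto elim!: eventually_mono simp: mult_ac\<close>)
  qed
  have fstF: "eventually (\<lambda>t. P (fst t)) F" if "eventually P sequentially" for P
    using that unfolding F_def by (auto simp: eventually_prod_principal elim: eventually_mono)
  have fst_inf: "filterlim (\<lambda>t. f (fst t)) G F" if "filterlim f G sequentially"
    for f :: "nat \<Rightarrow> complex" and G
    unfolding F_def by (rule filterlim_compose[OF that filterlim_fst])
  have sF: "\<forall>\<^sub>F t in F. norm (snd t) < 1"
    by (auto simp: F_def eventually_prod_principal)
  define h where "h t = snd t / \<Lambda> (fst t)" for t
  have h0: "(h \<longlongrightarrow> 0) F"
  proof (rule Lim_null_comparison)
    have "(\<lambda>k. inverse (\<Lambda> k)) \<longlonglongrightarrow> 0"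
      by (rule filterlim_compose[OF tendsto_inverse_0 \<Lambda>_inf])
    from fst_inf[OF this] show "((\<lambda>t. norm (inverse (\<Lambda> (fst t)))) \<longlongrightarrow> 0) F"
      by (rule tendsto_norm_zero)
    show "\<forall>\<^sub>F t in F. norm (h t) \<le> norm (inverse (\<Lambda> (fst t)))"
      using sF by eventually_elim (auto simp: h_def norm_divide norm_inverse field_simps \<Lambda>_def)
  qed
  \<comment> \<open>\<open>\<phi>\<close> is the relative error of \<open>exp w - 1\<close> against
    \<open>w\<close>; as \<open>\<Lambda> * h = s\<close>, the exponential moves by exactly
    \<open>s + s * \<phi> (h t)\<close>, and \<open>\<gamma>\<close> is the resulting
    factor.\<close>
  define \<phi> where "\<phi> w = (exp w - 1 - w) / w" for w :: complex
  define \<gamma> where "\<gamma> t = exp (snd t * \<phi> (h t))" for t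
  have \<gamma>1: "(\<gamma> \<longlongrightarrow> 1) F"
  proof -
    have "((\<lambda>t. snd t * \<phi> (h t)) \<longlongrightarrow> 0) F"
    proof (rule Lim_null_comparison)
      have "((\<lambda>t. \<phi> (h t)) \<longlongrightarrow> 0) F"
        unfolding \<phi>_def by (rule filterlim_compose[OF exp_minus_one_over_tendsto h0])
      then show "((\<lambda>t. norm (\<phi> (h t))) \<longlongrightarrow> 0) F" by (rule tendsto_norm_zero)
      show "\<forall>\<^sub>F t in F. norm (snd t * \<phi> (h t)) \<le> norm (\<phi> (h t))"
        using sF by eventually_elim (simp add: norm_mult mult_left_le_one_le)
    qed
    from tendsto_exp[OF this] show ?thesis by (simp add: \<gamma>_def[abs_def])
  qed
  have expexp: "\<forall>\<^sub>F t in F. exp (exp (z (fst t) + h t)) = Y (fst t) * exp (snd t) * \<gamma> t"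
    using fstF[OF exp\<Lambda>]
  proof eventually_elim
    case (elim t)
    let ?l = "\<Lambda> (fst t)"
    have l: "?l \<noteq> 0" by (simp add: \<Lambda>_def)
    then have "?l * (exp (h t) - 1) = snd t + snd t * \<phi> (h t)"
      by (cases "snd t = 0") (auto simp: \<phi>_def h_def field_simps)
    then have "exp (z (fst t) + h t) = ?l + (snd t + snd t * \<phi> (h t))"
      unfolding exp_add \<Lambda>_def[symmetric] by (simp add: algebra_simps)
    then show ?case by (simp add: exp_add elim \<gamma>_def)
  qed
  define e where "e t = Ln (1 + \<delta> (fst t)) + h t" for t
  have ze: "z (fst t) + h t = centre (fst t) + e t" for t
    by (simp add: z_def e_def)
  have e0: "(e \<longlongrightarrow> 0) F"
  proof -
    have "(\<lambda>k. Ln (1 + \<delta> k)) \<longlonglongrightarrow> Ln 1"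
      by (rule tendsto_Ln[OF \<delta>1]) (auto simp: complex_nonpos_Reals_iff)
    from tendsto_add[OF fst_inf[OF this] h0] show ?thesis by (simp add: e_def[abs_def])
  qed

  \<comment> \<open>The numerator is \<open>2 * pi * k * \<i> * u\<close> and the denominator
    \<open>L * v\<close>, with \<open>u\<close> and \<open>v\<close> tending to 1 and
    \<open>L\<close> real and positive. So the imaginary part has the sign of
    \<open>Re (u / v)\<close>.\<close>
  have off: "\<forall>\<^sub>F t in F. Im (exp (z (fst t) + h t) / (z (fst t) + h t)) \<noteq> 0"
  proof -
    define L where "L k = ln (2 * pi * real k)" for k
    have L: "filterlim (\<lambda>k. of_real (L k) :: complex) at_infinity sequentially"
    proof -
      have "filterlim L at_infinity sequentially" unfolding L_def by real_asymp
      then show ?thesis by (simp add: filterlim_at_infinity_conv_norm_at_top)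
    qed
    have Lpos: "\<forall>\<^sub>F k in sequentially. L k > 0" unfolding L_def by real_asymp
    define u where "u t = (1 + \<delta> (fst t)) * exp (h t)" for t
    define v where "v t = 1 + (\<i> * of_real (pi / 2) + e t) / of_real (L (fst t))" for t
    have "(u \<longlongrightarrow> 1 * exp 0) F"
      unfolding u_def by (intro tendsto_intros fst_inf[OF \<delta>1] h0)
    moreover have "(v \<longlongrightarrow> 1 + 0) F"
      unfolding v_def
      by (rule tendsto_add[OF tendsto_const
            tendsto_divide_0[OF tendsto_add[OF tendsto_const e0] fst_inf[OF L]]])
    ultimately have "((\<lambda>t. Re (u t / v t)) \<longlongrightarrow> Re (1 * exp 0 / (1 + 0))) F"
      by (intro tendsto_Re tendsto_divide) auto
    then have "\<forall>\<^sub>F t in F. Re (u t / v t) > 0"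
      by (rule order_tendstoD) simp
    then show ?thesis
      using fstF[OF \<Lambda>] fstF[OF Lpos] fstF[OF eventually_gt_at_top[of 0]]
    proof eventually_elim
      case (elim t)
      have "exp (z (fst t) + h t) = of_real (2 * pi * real (fst t)) * \<i> * u t"
        using elim unfolding exp_add \<Lambda>_def[symmetric] by (simp add: u_def)
      moreover have "z (fst t) + h t = of_real (L (fst t)) * v t"
        using elim unfolding ze by (simp add: v_def centre_def L_def field_simps)
      ultimately have "exp (z (fst t) + h t) / (z (fst t) + h t)
          = of_real (2 * pi * real (fst t) / L (fst t)) * (\<i> * (u t / v t))"
        by (simp add: field_simps)
      then have "Im (exp (z (fst t) + h t) / (z (fst t) + h t))
          = 2 * pi * real (fst t) / L (fst t) * Re (u t / v t)"
        by (simp only: times_complex.sel[of "of_real _"] Re_complex_of_real Im_complex_of_real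
            Im_i_times mult_zero_left add_0_right)
      then show ?case using elim by simp
    qed
  qed

  have M: "\<forall>\<^sub>F k in sequentially. M k > 0"
    using poly_centre_nonzero[OF p(1)]
  proof eventually_elim
    case (elim k)
    have "0 < norm (b k 0)" using elim by (simp add: b_def)
    also have "\<dots> \<le> M k" unfolding M_def by (rule member_le_sum) auto
    finally show ?case .
  qed

  obtain K where K: "\<And>k. k \<ge> K \<Longrightarrow> M k > 0 \<and> Y k \<noteq> 0 \<and> eval2 p (centre k) (Y k) = 0 \<and>
      (\<forall>s\<in>ball 0 1. Im (exp (z k + s / \<Lambda> k) / (z k + s / \<Lambda> k)) \<noteq> 0)"
    using eventually_conj[OF M eventually_conj[OF Y off[unfolded F_def eventually_prod_principal]]]
    unfolding eventually_sequentially by (auto simp: h_def)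

  define d where "d k i = b k i / of_real (M k)" for k i
  \<comment> \<open>Indices beyond \<open>n\<close> give 0, so the bound holds for all
    \<open>i\<close>, as the compactness lemma demands.\<close>
  have "norm (d k i) \<le> 1" for k i
  proof (cases "i \<le> n")
    case True
    have "norm (b k i) \<le> M k" unfolding M_def using True by (intro member_le_sum) auto
    moreover have "M k \<ge> 0" unfolding M_def by (intro sum_nonneg) auto
    ultimately show ?thesis by (cases "M k = 0") (simp_all add: d_def norm_divide divide_le_eq_1)
  next
    case False
    then show ?thesis by (simp add: d_def b_def n_def coeff_eq_0)
  qed
  then obtain D r0 where r0: "strict_mono r0" "\<And>i. i < Suc n \<Longrightarrow> (\<lambda>k. d (r0 k) i) \<longlonglongrightarrow> D i"
    using finite_family_convergent_subsequence[of d "Suc n"] by blast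
  \<comment> \<open>The shift by \<open>K\<close> makes the eventual facts hold for every member of
    the subsequence, the form in which Hurwitz's theorem is applied.\<close>
  define r where "r k = r0 (k + K)" for k
  have r: "strict_mono r" using r0(1) by (auto simp: r_def strict_mono_def)
  have rK: "r k \<ge> K" for k using seq_suble[OF r0(1), of "k + K"] by (simp add: r_def)
  have dD: "(\<lambda>k. d (r k) i) \<longlonglongrightarrow> D i" if "i \<le> n" for i
    using LIMSEQ_ignore_initial_segment[OF r0(2), of i K] that by (simp add: r_def)

  have rF: "filterlim (\<lambda>t. (r (fst t), snd t)) F F"
    unfolding F_def
    by (intro filterlim_Pair filterlim_snd filterlim_compose[OF filterlim_subseq[OF r] filterlim_fst])

  have summand: "((\<lambda>t. poly (coeff p i) (z (r (fst t)) + snd t / \<Lambda> (r (fst t))) *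
      exp (exp (z (r (fst t)) + snd t / \<Lambda> (r (fst t)))) ^ i / of_real (M (r (fst t))) - D i * exp (snd t) ^ i)
      \<longlongrightarrow> 0) F" if "i \<le> n" for i
  proof -
    \<comment> \<open>For a zero coefficient the value 1 keeps the limit 1; both sides of the
      factorisation are then 0.\<close>
    define \<rho> where "\<rho> t = (if coeff p i = 0 then 1
      else poly (coeff p i) (centre (fst t) + e t) / poly (coeff p i) (centre (fst t)))" for t
    have \<rho>1: "(\<rho> \<longlongrightarrow> 1) F"
    proof (cases "coeff p i = 0")
      case True
      then show ?thesis unfolding \<rho>_def by simp
    next
      case False
      then show ?thesis unfolding \<rho>_def
        using poly_shift_ratio_tendsto[OF False fst_inf[OF filterlim_centre] e0] by simp
    qed
    define f where "f t = \<rho> t * \<gamma> t ^ i" for t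
    have "(f \<longlongrightarrow> 1 * 1 ^ i) F" unfolding f_def by (intro tendsto_intros \<rho>1 \<gamma>1)
    then have f1: "((\<lambda>t. f (r (fst t), snd t)) \<longlongrightarrow> 1) F"
      using filterlim_compose[OF _ rF] by simp
    have "\<forall>\<^sub>F t in F. poly (coeff p i) (z (fst t) + h t) * exp (exp (z (fst t) + h t)) ^ i / of_real (M (fst t))
        = d (fst t) i * f t * exp (snd t) ^ i"
    proof (cases "coeff p i = 0")
      case False
      show ?thesis
        using expexp fstF[OF poly_centre_nonzero[OF False]]
        by eventually_elim
          (simp add: ze d_def b_def f_def \<rho>_def power_mult_distrib False)
    qed (simp add: d_def b_def)
    then have eq: "\<forall>\<^sub>F t in F. poly (coeff p i) (z (r (fst t)) + snd t / \<Lambda> (r (fst t))) *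
        exp (exp (z (r (fst t)) + snd t / \<Lambda> (r (fst t)))) ^ i / of_real (M (r (fst t)))
        = d (r (fst t)) i * f (r (fst t), snd t) * exp (snd t) ^ i"
      using filterlim_iff[THEN iffD1, OF rF] by (fastforce simp: h_def)
    have lim: "((\<lambda>t. d (r (fst t)) i * f (r (fst t), snd t) - D i) \<longlongrightarrow> 0) F"
      using tendsto_diff[OF tendsto_mult[OF fst_inf[OF dD[OF that]] f1] tendsto_const, of "D i"] by simp
    \<comment> \<open>On the unit disc \<open>exp s ^ i\<close> is bounded by
      \<open>exp 1 ^ i\<close>, so the coefficient error controls the whole term uniformly.\<close>
    show ?thesis
    proof (rule Lim_null_comparison)
      show "((\<lambda>t. norm (d (r (fst t)) i * f (r (fst t), snd t) - D i) * exp 1 ^ i) \<longlongrightarrow> 0) F"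
        by (rule tendsto_mult_left_zero[OF tendsto_norm_zero[OF lim]])
      show "\<forall>\<^sub>F t in F. norm (poly (coeff p i) (z (r (fst t)) + snd t / \<Lambda> (r (fst t))) *
          exp (exp (z (r (fst t)) + snd t / \<Lambda> (r (fst t)))) ^ i / of_real (M (r (fst t))) - D i * exp (snd t) ^ i)
          \<le> norm (d (r (fst t)) i * f (r (fst t), snd t) - D i) * exp 1 ^ i"
        using eq sF
      proof eventually_elim
        case (elim t)
        have "Re (snd t) \<le> 1" using elim(2) complex_Re_le_cmod[of "snd t"] by linarith
        then have "norm (exp (snd t) ^ i) \<le> exp 1 ^ i"
          by (simp add: norm_power power_mono)
        then show ?case
          unfolding elim(1) left_diff_distrib[symmetric] norm_mult by (intro mult_left_mono) auto
      qed
    qed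
  qed
  define G where "G s = (\<Sum>i\<le>n. D i * exp s ^ i)" for s
  have "((\<lambda>t. H (r (fst t)) (snd t) - G (snd t)) \<longlongrightarrow> (\<Sum>i\<le>n. 0)) F"
    unfolding H_def G_def eval2_altdef n_def[symmetric] sum_divide_distrib sum_subtractf[symmetric]
    by (intro tendsto_sum summand) auto
  then have unif: "uniform_limit (ball 0 1) (\<lambda>k. H (r k)) G sequentially"
    unfolding F_def by (intro uniform_limit_prod_principalI) (simp add: case_prod_unfold)

  \<comment> \<open>The normalisation passes to the limit, so some \<open>D i\<close> is
    nonzero.\<close>
  have sumD: "(\<Sum>i\<le>n. norm (D i)) = 1"
  proof (rule LIMSEQ_unique)
    show "(\<lambda>k. \<Sum>i\<le>n. norm (d (r k) i)) \<longlonglongrightarrow> (\<Sum>i\<le>n. norm (D i))"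
      by (intro tendsto_sum tendsto_norm dD) auto
    have "(\<Sum>i\<le>n. norm (d k i)) = 1" if "M k > 0" for k
      using that by (simp add: d_def norm_divide sum_divide_distrib[symmetric] flip: M_def)
    then show "(\<lambda>k. \<Sum>i\<le>n. norm (d (r k) i)) \<longlonglongrightarrow> 1" using K[OF rK] by simp
  qed
  have G0: "G 0 = 0"
  proof (rule LIMSEQ_unique)
    show "(\<lambda>k. \<Sum>i\<le>n. d (r k) i) \<longlonglongrightarrow> G 0"
      unfolding G_def by simp (intro tendsto_sum dD, auto)
    have "(\<Sum>i\<le>n. d k i) = eval2 p (centre k) (Y k) / of_real (M k)" for k
      by (simp add: d_def b_def eval2_altdef n_def sum_divide_distrib)
    then show "(\<lambda>k. \<Sum>i\<le>n. d (r k) i) \<longlonglongrightarrow> 0" using K[OF rK] by simp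
  qed
  have nonconst: "\<not> G constant_on ball 0 1"
  proof
    assume "G constant_on ball 0 1"
    then have G: "G s = 0" if "s \<in> ball 0 1" for s
      using that G0 unfolding constant_on_def by (metis centre_in_ball zero_less_one)
    \<comment> \<open>If \<open>G\<close> were constant, \<open>P\<close> would vanish at
      \<open>exp x\<close> for all real \<open>x\<close> between 0 and 1, hence be zero, against
      \<open>sumD\<close>.\<close>
    define P where "P = (\<Sum>i\<le>n. monom (D i) i)"
    have "poly P (exp s) = G s" for s
      by (simp add: P_def G_def poly_sum poly_monom)
    then have "(\<lambda>x. exp (of_real x)) ` {0<..<1::real} \<subseteq> {y. poly P y = 0}"
      using G by (auto simp: dist_norm)
    moreover have "infinite ((\<lambda>x. exp (of_real x) :: complex) ` {0<..<1::real})"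
      by (subst finite_image_iff) (auto intro!: inj_onI simp: exp_of_real)
    ultimately have "P = 0" using poly_roots_finite finite_subset by metis
    moreover have "coeff P i = D i" if "i \<le> n" for i
      using that by (simp add: P_def coeff_sum)
    ultimately have "(\<Sum>i\<le>n. norm (D i)) = 0" by (intro sum.neutral) auto
    with sumD show False by simp
  qed
  have "G 0 \<noteq> 0"
  proof (rule Hurwitz_no_zeros[of "ball 0 1" "\<lambda>k. H (r k)" G])
    show "H (r k) holomorphic_on ball 0 1" for k
      unfolding H_def eval2_altdef by (intro holomorphic_intros) (auto simp: \<Lambda>_def M_def)
    show "G holomorphic_on ball 0 1" unfolding G_def by (intro holomorphic_intros)
    show "uniform_limit C (\<lambda>k. H (r k)) G sequentially" if "C \<subseteq> ball 0 1" for C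
      using uniform_limit_on_subset[OF unif that] .
    show "H (r k) s \<noteq> 0" if "s \<in> ball 0 1" for k s
      using no K[OF rK[of k]] that unfolding H_def by force
  qed (use nonconst in auto)
  with G0 show False by simp
qed

section \<open>Irreducibility, linear independence and the conclusion\<close>

lemma unit_in_imp_is_unit: "unit_in R a \<Longrightarrow> is_unit a"
  unfolding unit_in_def by (metis dvdI)

text \<open>Otherwise \<open>y\<close> divides \<open>p\<close>; by irreducibility the cofactor is a
  unit, hence constant, and \<open>p\<close> does not depend on \<open>x\<close>.\<close>

lemma irreducible_coeff_0_nonzero:
  assumes "irreducible_in algebraic_poly2 p" "depends_on_x p"
  shows "coeff p 0 \<noteq> 0"
proof
  assume 0: "coeff p 0 = 0"
  obtain c q where p: "p = pCons c q" by (rule pCons_cases)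
  with 0 have pq: "p = [:0, 1:] * q" by simp
  have "[:0, 1:] \<in> algebraic_poly2"
    by (auto simp: algebraic_poly2_def coeff_pCons split: nat.splits)
  moreover have "q \<in> algebraic_poly2"
  proof -
    have "coeff q j = coeff p (Suc j)" for j by (simp add: p)
    then show ?thesis using assms(1) by (simp add: algebraic_poly2_def irreducible_in_def)
  qed
  ultimately have "unit_in algebraic_poly2 [:0, 1:] \<or> unit_in algebraic_poly2 q"
    using assms(1) pq unfolding irreducible_in_def by blast
  moreover have "\<not> unit_in algebraic_poly2 [:0, 1:]"
  proof
    assume "unit_in algebraic_poly2 [:0, 1:]"
    then have "is_unit ([:0, 1:] :: complex poly poly)" by (rule unit_in_imp_is_unit)
    then show False by (simp add: is_unit_iff_degree is_unit_poly_iff)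
  qed
  ultimately have "is_unit q" using unit_in_imp_is_unit by blast
  then obtain u where u: "q = [:u:]" "is_unit u" by (auto simp: is_unit_poly_iff)
  then have "degree u = 0" by (auto simp: is_unit_poly_iff)
  then have "degree (coeff p j) = 0" for j
    by (auto simp: pq u(1) coeff_pCons split: nat.splits)
  then show False using assms(2) by (simp add: depends_on_x_def)
qed

text \<open>A relation with a nonzero coefficient at \<open>b\<close> makes \<open>b / a\<close>
  rational, hence real. The assumption also excludes \<open>a = 0\<close>, since
  \<open>b / 0 = 0\<close>.\<close>

lemma rat_independent_pair:
  assumes "Im (b / a) \<noteq> 0"
  shows "a \<noteq> b" "rat.independent {a, b}"
proof -
  have a: "a \<noteq> 0" using assms by auto
  show ab: "a \<noteq> b" using assms a by auto
  show "rat.independent {a, b}"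
  proof (rule rat.independent_if_scalars_zero)
    fix f x assume "(\<Sum>x\<in>{a, b}. of_rat (f x) * x) = 0" and x: "x \<in> {a, b}"
    then have eq: "of_rat (f a) * a + of_rat (f b) * b = 0" using ab by simp
    have "f b = 0"
    proof (rule ccontr)
      assume "f b \<noteq> 0"
      then have "b / a = - of_rat (f a / f b)"
        using eq a by (simp add: of_rat_divide field_simps add_eq_0_iff)
      moreover have "of_rat q \<in> (\<real> :: complex set)" for q
        by (cases q) (simp add: of_rat_rat Reals_divide)
      ultimately have "b / a \<in> \<real>" by simp
      with assms show False by (simp add: complex_is_Real_iff)
    qed
    with eq a x show "f x = 0" by auto
  qed simp
qed

theorem theorem4p1:
  fixes p :: "complex poly poly"
  assumes "schanuel_conjecture"
    and "irreducible_in algebraic_poly2 p"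
    and "depends_on_x p"
    and "depends_on_y p"
    and "\<not> (\<exists>(c::complex) (m::nat). p = monom [:c:] m)"
  shows "\<exists>w::complex. eval2 p w (exp (exp w)) = 0
           \<and> trdeg {w, exp w, exp (exp w)} = 2"
proof -
  have "degree p > 0" using assms(4) by (simp add: depends_on_y_def)
  then obtain w where w: "eval2 p w (exp (exp w)) = 0" "Im (exp w / w) \<noteq> 0"
    using exists_zero_off_real_lines irreducible_coeff_0_nonzero assms(2,3) by blast
  have "p \<noteq> 0" "\<And>i j. algebraic (coeff (coeff p j) i)"
    using assms(2) by (auto simp: irreducible_in_def algebraic_poly2_def)
  then have le: "trdeg {w, exp w, exp (exp w)} \<le> 2" using w(1) by (rule trdeg_le_2)
  \<comment> \<open>For the family \<open>w\<close>, \<open>exp w\<close> the exponentials repeat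
    \<open>exp w\<close>, so the field in Schanuel's conjecture is generated by exactly the three
    numbers of the goal.\<close>
  define l where "l i = (if i = 1 then w else exp w)" for i :: nat
  have two: "{1..2::nat} = {1, 2}" by auto
  have "l ` {1..2} = {w, exp w}" "inj_on l {1..2}"
    using rat_independent_pair(1)[OF w(2)] unfolding two by (auto simp: l_def)
  then have "enat 2 \<le> trdeg (l ` {1..2} \<union> (\<lambda>i. exp (l i)) ` {1..2})"
    using assms(1) rat_independent_pair(2)[OF w(2)] unfolding schanuel_conjecture_def by metis
  also have "l ` {1..2} \<union> (\<lambda>i. exp (l i)) ` {1..2} = {w, exp w, exp (exp w)}"
    unfolding two by (auto simp: l_def)
  finally have "trdeg {w, exp w, exp (exp w)} = 2"
    using le by (simp add: numeral_eq_enat)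
  with w(1) show ?thesis by blast
qed

end
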